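(* Let $\alpha,\beta,\sigma>0$ and $\gamma>0$. Then the following Turán type inequality $$W_{\alpha,\beta}^{\gamma,\sigma}(z)\, W_{\alpha,\beta}^{\gamma+2,\sigma}(z)-\frac{\gamma}{\gamma+1} \big(W_{\alpha,\beta}^{\gamma+1,\sigma}(z)\big)^2\geq0$$ holds true for all $z>0$.
   Context: $\Gamma$ is the Gamma function. The generalized Wright function is $W_{\alpha,\beta}^{\gamma,\sigma}(z)=\sum_{n=0}^\infty\frac{(\gamma)_n}{(\sigma)_n\Gamma(\alpha n+\beta)}\frac{z^n}{n!}$, where $(\tau)_n=\frac{\Gamma(\tau+n)}{\Gamma(\tau)}=\tau(\tau+1)\cdots(\tau+n-1)$ is the Pochhammer symbol. *)

theory Defs
  imports "HOL-Analysis.Analysis"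
begin

text \<open>
  The generalized Wright function for real parameters and real argument. For \<open>\<alpha> > 0\<close>,
  \<open>\<beta> > 0\<close>, \<open>\<sigma> > 0\<close> the series converges for every \<open>z\<close>, so \<open>suminf\<close> is its genuine sum.
\<close>

definition gen_Wright :: "real \<Rightarrow> real \<Rightarrow> real \<Rightarrow> real \<Rightarrow> real \<Rightarrow> real" where
  "gen_Wright \<alpha> \<beta> \<gamma> \<sigma> z =
     (\<Sum>n. pochhammer \<gamma> n / (pochhammer \<sigma> n * Gamma (\<alpha> * real n + \<beta>)) * (z ^ n / fact n))"

end

theory Submission
  imports Defs "HOL-Real_Asymp.Real_Asymp"
begin

text \<open>
  The inequality holds termwise: \<open>\<Gamma>(\<gamma>) (\<gamma>)\<^sub>n = \<Gamma>(\<gamma> + n)\<close> is log-convex in \<open>\<gamma>\<close>, and passing from \<open>(\<gamma>)\<^sub>n\<close>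
  to \<open>\<Gamma>(\<gamma> + n)\<close> is what produces the factor \<open>\<gamma> / (\<gamma> + 1)\<close>. By Cauchy--Schwarz, termwise bounds
  \<open>g\<^sub>n\<^sup>2 \<le> f\<^sub>n h\<^sub>n\<close> between nonnegative series carry over to their sums.
\<close>

lemma suminf_squared_le:
  fixes f g h :: "nat \<Rightarrow> real"
  assumes nonneg: "\<And>n. f n \<ge> 0" "\<And>n. g n \<ge> 0" "\<And>n. h n \<ge> 0"
    and le: "\<And>n. (g n)\<^sup>2 \<le> f n * h n"
    and summable: "summable f" "summable g" "summable h"
  shows "(suminf g)\<^sup>2 \<le> suminf f * suminf h"
proof (rule LIMSEQ_le)
  show "(\<lambda>n. (sum g {..<n})\<^sup>2) \<longlonglongrightarrow> (suminf g)\<^sup>2"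
    by (intro tendsto_intros summable_LIMSEQ summable)
  show "(\<lambda>n. sum f {..<n} * sum h {..<n}) \<longlonglongrightarrow> suminf f * suminf h"
    by (intro tendsto_intros summable_LIMSEQ summable)
  have "(sum g {..<n})\<^sup>2 \<le> sum f {..<n} * sum h {..<n}" for n
  proof -
    \<comment> \<open>The hypothesis gives \<open>g k \<le> sqrt (f k) * sqrt (h k)\<close>, so
      finite Cauchy--Schwarz can be applied to the vectors of square roots, whose squares sum back
      to the partial sums of \<open>f\<close> and \<open>h\<close>.\<close>
    have "sum g {..<n} \<le> (\<Sum>k<n. sqrt (f k) * sqrt (h k))"
      by (intro sum_mono) (simp add: le real_le_rsqrt flip: real_sqrt_mult)
    then have "(sum g {..<n})\<^sup>2 \<le> (\<Sum>k<n. sqrt (f k) * sqrt (h k))\<^sup>2"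
      by (intro power_mono sum_nonneg nonneg)
    also have "\<dots> \<le> (\<Sum>k<n. (sqrt (f k))\<^sup>2) * (\<Sum>k<n. (sqrt (h k))\<^sup>2)"
      by (rule Cauchy_Schwarz_ineq_sum)
    finally show ?thesis
      by (simp add: nonneg)
  qed
  then show "\<exists>N. \<forall>n\<ge>N. (sum g {..<n})\<^sup>2 \<le> sum f {..<n} * sum h {..<n}"
    by blast
qed

text \<open>The right side is exactly \<open>(a + 1 + n) / (a + n)\<close> times the left, and this
  factor is at least 1. The proof clears the denominator \<open>a + n\<close> and cancels it at the
  end.\<close>

lemma pochhammer_Turan:
  fixes a :: real
  assumes "a > 0"
  shows "a * (pochhammer (a + 1) n)\<^sup>2 \<le> (a + 1) * (pochhammer a n * pochhammer (a + 2) n)"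
proof -
  \<comment> \<open>Both sides are \<open>pochhammer b (Suc n)\<close>, with the first or the last
    factor split off.\<close>
  have shift: "b * pochhammer (b + 1) n = (b + real n) * pochhammer b n" for b :: real
    by (metis pochhammer_rec pochhammer_rec')
  let ?p = "pochhammer (a + 1) n"
  have eq: "(a + real n) * ((a + 1) * (pochhammer a n * pochhammer (a + 2) n))
      = a * (a + 1 + real n) * ?p\<^sup>2"
    using shift[of a] shift[of "a + 1"] by (simp add: add.assoc power2_eq_square) algebra
  have "(a + real n) * (a * ?p\<^sup>2) \<le> (a + 1 + real n) * (a * ?p\<^sup>2)"
    using assms by (intro mult_right_mono) auto
  also have "\<dots> = (a + real n) * ((a + 1) * (pochhammer a n * pochhammer (a + 2) n))"
    unfolding eq by simp
  finally show ?thesis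
    using assms by (simp add: mult_le_cancel_left_pos)
qed

definition Wright_term :: "real \<Rightarrow> real \<Rightarrow> real \<Rightarrow> real \<Rightarrow> real \<Rightarrow> nat \<Rightarrow> real" where
  "Wright_term \<alpha> \<beta> \<gamma> \<sigma> z n =
     pochhammer \<gamma> n / (pochhammer \<sigma> n * Gamma (\<alpha> * real n + \<beta>)) * (z ^ n / fact n)"

lemma Wright_term_pos:
  assumes "\<alpha> > 0" "\<beta> > 0" "\<sigma> > 0" "\<gamma> > 0" "z > 0"
  shows "Wright_term \<alpha> \<beta> \<gamma> \<sigma> z n > 0"
  unfolding Wright_term_def using assms
  by (intro mult_pos_pos divide_pos_pos pochhammer_pos Gamma_real_pos zero_less_power
      add_nonneg_pos) auto

text \<open>Ratio test: the quotient of consecutive terms is a rational function of \<open>n\<close>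
  tending to 0, times a quotient of Gamma values that is eventually at most 1. No asymptotics of
  Gamma are required, only its monotonicity.\<close>

lemma summable_Wright_term:
  assumes pos: "\<alpha> > 0" "\<beta> > 0" "\<sigma> > 0" "\<gamma> > 0" "z > 0"
  shows "summable (Wright_term \<alpha> \<beta> \<gamma> \<sigma> z)"
proof -
  have "(\<lambda>n. (\<gamma> + real n) * z / ((\<sigma> + real n) * (1 + real n))) \<longlonglongrightarrow> 0"
    by real_asymp
  then have "\<forall>\<^sub>F n in sequentially. (\<gamma> + real n) * z / ((\<sigma> + real n) * (1 + real n)) < 1/2"
    by (rule order_tendstoD) simp
  moreover have "filterlim (\<lambda>n. \<alpha> * real n + \<beta>) at_top sequentially"
    using pos by real_asymp
  \<comment> \<open>Gamma is strictly increasing on [3/2, infinity), so beyond this threshold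
    \<open>?G n < ?G (Suc n)\<close>.\<close>
  then have "\<forall>\<^sub>F n in sequentially. 3/2 \<le> \<alpha> * real n + \<beta>"
    unfolding filterlim_at_top by blast
  ultimately have "\<forall>\<^sub>F n in sequentially. (\<gamma> + real n) * z / ((\<sigma> + real n) * (1 + real n)) < 1/2
      \<and> 3/2 \<le> \<alpha> * real n + \<beta>"
    by (rule eventually_conj)
  then obtain N where N: "\<And>n. n \<ge> N \<Longrightarrow> (\<gamma> + real n) * z / ((\<sigma> + real n) * (1 + real n)) < 1/2"
      "\<And>n. n \<ge> N \<Longrightarrow> 3/2 \<le> \<alpha> * real n + \<beta>"
    unfolding eventually_sequentially by blast
  show ?thesis
  proof (rule summable_ratio_test[of "1/2" N])
    fix n assume n: "n \<ge> N"
    let ?r = "(\<gamma> + real n) * z / ((\<sigma> + real n) * (1 + real n))"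
    let ?G = "\<lambda>k. Gamma (\<alpha> * real k + \<beta>)"
    let ?t = "Wright_term \<alpha> \<beta> \<gamma> \<sigma> z"
    have G: "?G n > 0" "?G (Suc n) > 0"
      using pos by (intro Gamma_real_pos add_nonneg_pos; simp)+
    have "?G n < ?G (Suc n)"
      using N(2)[OF n] pos by (intro Gamma_real_strict_mono) (auto simp: algebra_simps)
    then have q: "?G n / ?G (Suc n) \<le> 1"
      using G by simp
    have t: "?t n > 0" "?t (Suc n) > 0"
      using pos by (simp_all add: Wright_term_pos)
    have "pochhammer \<sigma> n > 0" "\<sigma> + real n > 0"
      using pos by (auto intro: pochhammer_pos)
    then have "?t (Suc n) = ?r * (?G n / ?G (Suc n)) * ?t n"
      using G unfolding Wright_term_def pochhammer_rec' by (simp add: divide_simps)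
    also have "\<dots> \<le> 1/2 * 1 * ?t n"
      using N(1)[OF n] q t G by (intro mult_right_mono mult_mono) auto
    finally show "norm (?t (Suc n)) \<le> 1/2 * norm (?t n)"
      using t by simp
  qed simp
qed

theorem theorem5:
  fixes \<alpha> \<beta> \<gamma> \<sigma> z :: real
  assumes "\<alpha> > 0" and "\<beta> > 0" and "\<sigma> > 0" and "\<gamma> > 0" and "z > 0"
  shows "gen_Wright \<alpha> \<beta> \<gamma> \<sigma> z * gen_Wright \<alpha> \<beta> (\<gamma> + 2) \<sigma> z
           - \<gamma> / (\<gamma> + 1) * (gen_Wright \<alpha> \<beta> (\<gamma> + 1) \<sigma> z)\<^sup>2 \<ge> 0"
proof -
  let ?t = "\<lambda>\<gamma>. Wright_term \<alpha> \<beta> \<gamma> \<sigma> z"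
  let ?c = "(\<gamma> + 1) / \<gamma>"
  have W: "gen_Wright \<alpha> \<beta> \<delta> \<sigma> z = suminf (?t \<delta>)" for \<delta>
    by (simp only: gen_Wright_def flip: Wright_term_def)
  have pos: "?t \<delta> n > 0" and summable: "summable (?t \<delta>)" if "\<delta> > 0" for \<delta> n
    using assms that by (simp_all add: Wright_term_pos summable_Wright_term)
  \<comment> \<open>The constant \<open>?c\<close>, the reciprocal of the factor in the claim, is
    absorbed into the third series so that the termwise bound takes the form
    \<open>g\<^sup>2 \<le> f * h\<close>.\<close>
  have "(suminf (?t (\<gamma> + 1)))\<^sup>2 \<le> suminf (?t \<gamma>) * suminf (\<lambda>n. ?c * ?t (\<gamma> + 2) n)"
  proof (rule suminf_squared_le)
    fix n
    \<comment> \<open>\<open>?w\<close> collects everything independent of the upper parameter, so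
      the termwise bound is \<open>pochhammer_Turan\<close> scaled by
      \<open>?w\<^sup>2\<close>.\<close>
    let ?w = "z ^ n / fact n / (pochhammer \<sigma> n * Gamma (\<alpha> * real n + \<beta>))"
    have t: "?t \<delta> n = pochhammer \<delta> n * ?w" for \<delta>
      by (simp add: Wright_term_def)
    have "(pochhammer (\<gamma> + 1) n)\<^sup>2 \<le> ?c * (pochhammer \<gamma> n * pochhammer (\<gamma> + 2) n)"
      using pochhammer_Turan[OF \<open>\<gamma> > 0\<close>, of n] \<open>\<gamma> > 0\<close> by (simp add: field_simps)
    then have "(pochhammer (\<gamma> + 1) n)\<^sup>2 * ?w\<^sup>2
        \<le> ?c * (pochhammer \<gamma> n * pochhammer (\<gamma> + 2) n) * ?w\<^sup>2"
      by (rule mult_right_mono) simp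
    then show "(?t (\<gamma> + 1) n)\<^sup>2 \<le> ?t \<gamma> n * (?c * ?t (\<gamma> + 2) n)"
      unfolding t by (simp only: power_mult_distrib power2_eq_square mult_ac)
  qed (use assms pos in \<open>auto intro!: summable summable_mult mult_nonneg_nonneg divide_nonneg_pos less_imp_le[OF pos]\<close>)
  also have "suminf (\<lambda>n. ?c * ?t (\<gamma> + 2) n) = ?c * suminf (?t (\<gamma> + 2))"
    using assms by (intro suminf_mult summable) simp
  finally show ?thesis
    unfolding W using assms by (simp add: field_simps)
qed

end
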